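(* Write $q_m:=t_1(t_2t_1)\cdots(t_mt_{m-1}\cdots t_1)$. The relations $$t_i^2=I,\qquad t_it_j=t_jt_i\ \text{ if } |i-j|>1,\qquad (t_i\,q_{k-1}q_{k-j}q_{k-1})^2=I\ \text{ for } i+1<j<k$$ on generators $t_i$ $(i\ge1)$ are equivalent to the relations $$q_{[i,j]}^2=I,\qquad q_{[i,j]}q_{[k,l]}q_{[i,j]}=q_{[i+j-l,\,i+j-k]}\ \text{ if } i\le k<l\le j,\qquad q_{[i,j]}q_{[k,l]}=q_{[k,l]}q_{[i,j]}\ \text{ if } j<k$$ on generators $q_{[i,j]}$ $(1\le i<j)$. That is, the homomorphisms between free groups given by $q_{[i,j]}\mapsto q_{j-1}q_{j-i}q_{j-1}$ and by $$t_1\mapsto q_{[1,2]},\quad t_2\mapsto q_{[1,2]}q_{[1,3]}q_{[1,2]},\quad t_i\mapsto q_{[1,i]}q_{[1,i+1]}q_{[1,i]}q_{[1,i-1]}\ \text{ for } i>2$$ descend to mutually inverse isomorphisms between the group generated by the $q_{[i,j]}$ subject to the second set of relations and the group generated by the $t_i$ subject to the first set of relations.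
   Context: All indices are positive integers; $I$ denotes the identity element. The groups are abstract groups given by generators and relations, with infinitely many generators. *)

theory Defs
  imports "HOL-Algebra.Coset"
begin

section \<open>Free groups and group presentations\<close>

text \<open>
  A letter \<open>(a, True)\<close> stands for the generator \<open>a\<close> and \<open>(a, False)\<close> for its inverse.
  The free group on \<open>S\<close> is realised on the reduced words over \<open>S\<close>.
\<close>

definition flip :: "'a \<times> bool \<Rightarrow> 'a \<times> bool" where
  "flip l = (fst l, \<not> snd l)"

definition reduced :: "('a \<times> bool) list \<Rightarrow> bool" where
  "reduced w \<longleftrightarrow> successively (\<lambda>l m. m \<noteq> flip l) w"

fun push :: "'a \<times> bool \<Rightarrow> ('a \<times> bool) list \<Rightarrow> ('a \<times> bool) list" where
  "push l [] = [l]"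
| "push l (m # w) = (if m = flip l then w else l # m # w)"

definition free_group :: "'a set \<Rightarrow> ('a \<times> bool) list monoid" where
  "free_group S =
     \<lparr> carrier = {w. w \<in> lists (S \<times> UNIV) \<and> reduced w},
       monoid.mult = (\<lambda>v w. foldr push v w),
       one = [] \<rparr>"

definition free_gen :: "'a \<Rightarrow> ('a \<times> bool) list" where
  "free_gen a = [(a, True)]"

definition free_lift :: "('b, 'c) monoid_scheme \<Rightarrow> ('a \<Rightarrow> 'b) \<Rightarrow> ('a \<times> bool) list \<Rightarrow> 'b" where
  "free_lift G f w =
     foldr (\<lambda>(a, b) x. (if b then f a else inv\<^bsub>G\<^esub> f a) \<otimes>\<^bsub>G\<^esub> x) w \<one>\<^bsub>G\<^esub>"

definition normal_closure :: "('b, 'c) monoid_scheme \<Rightarrow> 'b set \<Rightarrow> 'b set" where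
  "normal_closure G R = \<Inter> {N. N \<lhd> G \<and> R \<subseteq> N}"

text \<open>A relation \<open>u = v\<close> is given as the pair \<open>(u, v)\<close> of elements of the free group.\<close>

definition relation_subgroup ::
  "'a set \<Rightarrow> (('a \<times> bool) list \<times> ('a \<times> bool) list) set \<Rightarrow> ('a \<times> bool) list set" where
  "relation_subgroup S R =
     normal_closure (free_group S)
       {u \<otimes>\<^bsub>free_group S\<^esub> inv\<^bsub>free_group S\<^esub> v | u v. (u, v) \<in> R}"

definition presented_group ::
  "'a set \<Rightarrow> (('a \<times> bool) list \<times> ('a \<times> bool) list) set \<Rightarrow> ('a \<times> bool) list set monoid" where
  "presented_group S R = free_group S Mod relation_subgroup S R"

lemma flip_flip [simp]: "flip (flip l) = l"
  by (simp add: flip_def)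

lemma reduced_Nil [simp]: "reduced []"
  by (simp add: reduced_def)

lemma reduced_Cons: "reduced (l # w) \<longleftrightarrow> (w = [] \<or> hd w \<noteq> flip l) \<and> reduced w"
  by (auto simp: reduced_def successively_Cons)

lemma reduced_push: "reduced w \<Longrightarrow> reduced (push l w)"
  by (cases w) (auto simp: reduced_Cons)

lemma push_flip: "reduced w \<Longrightarrow> push l (push (flip l) w) = w"
  by (cases w) (auto simp: reduced_Cons; cases "tl w"; auto)+

lemma push_flip': "reduced w \<Longrightarrow> push (flip l) (push l w) = w"
  using push_flip[of w "flip l"] by simp

lemma reduced_foldr_push: "reduced w \<Longrightarrow> reduced (foldr push v w)"
  by (induction v) (auto intro: reduced_push)

lemma foldr_push_push:
  assumes "reduced w"
  shows "foldr push (push l v) w = push l (foldr push v w)"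
proof (cases v)
  case (Cons m v')
  then show ?thesis
    using push_flip[OF reduced_foldr_push[OF assms, of v'], of l] by auto
qed simp

lemma foldr_push_assoc:
  "reduced w \<Longrightarrow> foldr push (foldr push u v) w = foldr push u (foldr push v w)"
  by (induction u) (auto simp: foldr_push_push)

lemma foldr_push_Nil: "reduced w \<Longrightarrow> foldr push w [] = w"
proof (induction w)
  case (Cons l w)
  then show ?case by (cases w) (auto simp: reduced_Cons)
qed simp

lemma foldr_push_inverse: "reduced w \<Longrightarrow> foldr push (rev (map flip w)) w = []"
proof (induction w)
  case (Cons l w)
  then show ?case by (auto simp: reduced_Cons)
qed simp

lemma push_in_lists: "l \<in> A \<Longrightarrow> w \<in> lists A \<Longrightarrow> push l w \<in> lists A"
  by (cases w) auto

lemma foldr_push_in_lists: "v \<in> lists A \<Longrightarrow> w \<in> lists A \<Longrightarrow> foldr push v w \<in> lists A"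
  by (induction v) (simp_all add: push_in_lists del: in_lists_conv_set)

lemma group_free_group: "group (free_group S)"
proof (rule groupI)
  fix w assume "w \<in> carrier (free_group S)"
  then have w: "w \<in> lists (S \<times> UNIV)" "reduced w" by (auto simp: free_group_def)
  let ?v = "foldr push (rev (map flip w)) []"
  have "rev (map flip w) \<in> lists (S \<times> UNIV)"
    using w(1) by (force simp: flip_def)
  then have "?v \<in> carrier (free_group S)"
    by (simp add: free_group_def reduced_foldr_push foldr_push_in_lists del: in_lists_conv_set)
  moreover have "?v \<otimes>\<^bsub>free_group S\<^esub> w = \<one>\<^bsub>free_group S\<^esub>"
    using foldr_push_assoc[OF w(2), of "rev (map flip w)" "[]"] foldr_push_inverse[OF w(2)]
    by (simp add: free_group_def)
  ultimately show "\<exists>v\<in>carrier (free_group S). v \<otimes>\<^bsub>free_group S\<^esub> w = \<one>\<^bsub>free_group S\<^esub>"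
    by blast
qed (simp_all add: free_group_def reduced_foldr_push foldr_push_in_lists foldr_push_assoc
       del: in_lists_conv_set)

lemma free_gen_closed: "a \<in> S \<Longrightarrow> free_gen a \<in> carrier (free_group S)"
  by (simp add: free_gen_def free_group_def reduced_Cons)

lemma free_lift_closed:
  fixes G (structure)
  assumes "group G" and f: "f \<in> S \<rightarrow> carrier G" and w: "w \<in> lists (S \<times> UNIV)"
  shows "free_lift G f w \<in> carrier G"
proof -
  interpret group G by fact
  show ?thesis using w f by (induction w) (auto simp: free_lift_def Pi_iff)
qed

lemma free_lift_push:
  fixes G (structure)
  assumes "group G" and f: "f \<in> S \<rightarrow> carrier G"
    and l: "l \<in> S \<times> UNIV" and w: "w \<in> lists (S \<times> UNIV)"
  shows "free_lift G f (push l w) = free_lift G f [l] \<otimes> free_lift G f w"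
proof -
  interpret group G by fact
  obtain a b where ab: "l = (a, b)" by (cases l)
  have a: "f a \<in> carrier G" using f l ab by auto
  show ?thesis
  proof (cases w)
    case Nil
    then show ?thesis using a ab by (simp add: free_lift_def)
  next
    case (Cons m w')
    then have "free_lift G f w' \<in> carrier G"
      using w free_lift_closed[OF assms(1) f] by simp
    then show ?thesis
      using Cons a ab w f
      by (auto simp: free_lift_def flip_def m_assoc[symmetric] Pi_iff)
  qed
qed

lemma free_lift_hom:
  fixes G (structure)
  assumes "group G" and f: "f \<in> S \<rightarrow> carrier G"
  shows "free_lift G f \<in> hom (free_group S) G"
proof (rule homI)
  interpret group G by fact
  note closed = free_lift_closed[OF assms(1) f]
  fix v w assume "v \<in> carrier (free_group S)" "w \<in> carrier (free_group S)"
  then have vw: "v \<in> lists (S \<times> UNIV)" "w \<in> lists (S \<times> UNIV)"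
    by (auto simp: free_group_def)
  show "free_lift G f v \<in> carrier G"
    using vw by (auto intro!: closed)
  have "free_lift G f (foldr push v w) = free_lift G f v \<otimes> free_lift G f w"
    using vw(1)
  proof (induction v)
    case Nil
    then show ?case using closed[OF vw(2)] by (simp add: free_lift_def)
  next
    case (Cons l v)
    have l: "l \<in> S \<times> UNIV" and v: "v \<in> lists (S \<times> UNIV)" using Cons.hyps by auto
    have "free_lift G f (l # v) = free_lift G f [l] \<otimes> free_lift G f v"
      using l f by (cases l) (auto simp: free_lift_def Pi_iff)
    moreover have "free_lift G f [l] \<in> carrier G"
      using l by (auto intro!: closed)
    ultimately show ?case
      using Cons.IH free_lift_push[OF assms(1) f l foldr_push_in_lists[OF v vw(2)]]
        closed[OF v] closed[OF vw(2)]
      by (simp add: m_assoc)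
  qed
  then show "free_lift G f (v \<otimes>\<^bsub>free_group S\<^esub> w) = free_lift G f v \<otimes> free_lift G f w"
    by (simp add: free_group_def)
qed

lemma free_lift_free_gen:
  assumes "group G" "f a \<in> carrier G"
  shows "free_lift G f (free_gen a) = f a"
  using assms by (simp add: free_lift_def free_gen_def group.is_monoid monoid.r_one)

lemma free_lift_unique:
  assumes "group G" and h: "h \<in> hom (free_group S) G"
    and gen: "\<And>a. a \<in> S \<Longrightarrow> h (free_gen a) = f a" and w: "w \<in> carrier (free_group S)"
  shows "h w = free_lift G f w"
proof -
  interpret F: group "free_group S" by (rule group_free_group)
  interpret group_hom "free_group S" G h
    using assms(1) h by (simp add: group_hom_def group_hom_axioms_def group_free_group)
  have "w \<in> lists (S \<times> UNIV)" "reduced w" using w by (auto simp: free_group_def)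
  then show ?thesis
  proof (induction w)
    case Nil
    show ?case using hom_one by (simp add: free_lift_def free_group_def)
  next
    case (Cons l w)
    obtain a b where ab: "l = (a, b)" by (cases l)
    have a: "a \<in> S" using Cons.hyps ab by auto
    have w: "w \<in> carrier (free_group S)"
      using Cons by (auto simp: free_group_def reduced_Cons)
    have l: "[l] \<in> carrier (free_group S)"
      using a ab by (simp add: free_group_def reduced_Cons)
    have "l # w = push l w"
      using Cons.prems by (cases w) (auto simp: reduced_Cons)
    then have "l # w = [l] \<otimes>\<^bsub>free_group S\<^esub> w"
      by (simp add: free_group_def)
    then have "h (l # w) = h [l] \<otimes>\<^bsub>G\<^esub> h w"
      using l w by (simp add: hom_mult)
    moreover have "h [l] = (if b then f a else inv\<^bsub>G\<^esub> f a)"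
    proof (cases b)
      case True
      then show ?thesis using gen[OF a] ab by (simp add: free_gen_def)
    next
      case False
      have "[l] \<otimes>\<^bsub>free_group S\<^esub> free_gen a = \<one>\<^bsub>free_group S\<^esub>"
        using False ab by (simp add: free_group_def free_gen_def flip_def)
      then have "[l] = inv\<^bsub>free_group S\<^esub> free_gen a"
        using F.inv_equality[OF _ free_gen_closed[OF a] l] by simp
      then show ?thesis using False gen[OF a] free_gen_closed[OF a] by simp
    qed
    ultimately show ?case
      using Cons.IH Cons.prems ab by (simp add: free_lift_def reduced_Cons)
  qed
qed

lemma normal_closure_normal:
  assumes "group G" "R \<subseteq> carrier G"
  shows "normal_closure G R \<lhd> G"
proof -
  interpret group G by fact
  have ne: "carrier G \<in> {N. N \<lhd> G \<and> R \<subseteq> N}"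
    using assms normal_inv_iff subgroup_self by auto
  have "subgroup (normal_closure G R) G"
    unfolding normal_closure_def
    by (rule subgroups_Inter) (use ne normal_imp_subgroup in auto)
  then show ?thesis
    unfolding normal_inv_iff using normal_inv_iff by (auto simp: normal_closure_def)
qed

lemma group_presented_group:
  assumes "R \<subseteq> carrier (free_group S) \<times> carrier (free_group S)"
  shows "group (presented_group S R)"
proof -
  interpret group "free_group S" by (rule group_free_group)
  have "relation_subgroup S R \<lhd> free_group S"
    unfolding relation_subgroup_def
    by (rule normal_closure_normal) (use assms in \<open>auto simp: is_group\<close>)
  then show ?thesis
    unfolding presented_group_def by (rule normal.factorgroup_is_group)
qed


section \<open>The two presentations\<close>

text \<open>\<open>tprod G t m\<close> is $t_m t_{m-1} \cdots t_1$, and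
  \<open>q G t m\<close> is $t_1 (t_2 t_1) \cdots (t_m t_{m-1} \cdots t_1)$.\<close>

primrec tprod :: "('b, 'c) monoid_scheme \<Rightarrow> (nat \<Rightarrow> 'b) \<Rightarrow> nat \<Rightarrow> 'b" where
  "tprod G t 0 = \<one>\<^bsub>G\<^esub>"
| "tprod G t (Suc m) = t (Suc m) \<otimes>\<^bsub>G\<^esub> tprod G t m"

primrec q :: "('b, 'c) monoid_scheme \<Rightarrow> (nat \<Rightarrow> 'b) \<Rightarrow> nat \<Rightarrow> 'b" where
  "q G t 0 = \<one>\<^bsub>G\<^esub>"
| "q G t (Suc m) = q G t m \<otimes>\<^bsub>G\<^esub> tprod G t (Suc m)"

definition t_index :: "nat set" where
  "t_index = {i. 1 \<le> i}"

definition q_index :: "(nat \<times> nat) set" where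
  "q_index = {(i, j). 1 \<le> i \<and> i < j}"

abbreviation FT :: "(nat \<times> bool) list monoid" where
  "FT \<equiv> free_group t_index"

abbreviation FQ :: "((nat \<times> nat) \<times> bool) list monoid" where
  "FQ \<equiv> free_group q_index"

abbreviation tg :: "nat \<Rightarrow> (nat \<times> bool) list" where
  "tg i \<equiv> free_gen i"

abbreviation qt :: "nat \<Rightarrow> (nat \<times> bool) list" where
  "qt m \<equiv> q FT tg m"

abbreviation qg :: "nat \<Rightarrow> nat \<Rightarrow> ((nat \<times> nat) \<times> bool) list" where
  "qg i j \<equiv> free_gen (i, j)"

definition t_relations :: "((nat \<times> bool) list \<times> (nat \<times> bool) list) set" where
  "t_relations =
     {(tg i [^]\<^bsub>FT\<^esub> (2::nat), \<one>\<^bsub>FT\<^esub>) | i. 1 \<le> i}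
   \<union> {(tg i \<otimes>\<^bsub>FT\<^esub> tg j, tg j \<otimes>\<^bsub>FT\<^esub> tg i) | i j.
        1 \<le> i \<and> 1 \<le> j \<and> \<bar>int i - int j\<bar> > 1}
   \<union> {((tg i \<otimes>\<^bsub>FT\<^esub> qt (k - 1) \<otimes>\<^bsub>FT\<^esub> qt (k - j) \<otimes>\<^bsub>FT\<^esub> qt (k - 1)) [^]\<^bsub>FT\<^esub> (2::nat), \<one>\<^bsub>FT\<^esub>) | i j k.
        1 \<le> i \<and> i + 1 < j \<and> j < k}"

definition q_relations ::
  "(((nat \<times> nat) \<times> bool) list \<times> ((nat \<times> nat) \<times> bool) list) set" where
  "q_relations =
     {(qg i j [^]\<^bsub>FQ\<^esub> (2::nat), \<one>\<^bsub>FQ\<^esub>) | i j. 1 \<le> i \<and> i < j}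
   \<union> {(qg i j \<otimes>\<^bsub>FQ\<^esub> qg k l \<otimes>\<^bsub>FQ\<^esub> qg i j, qg (i + j - l) (i + j - k)) | i j k l.
        1 \<le> i \<and> i \<le> k \<and> k < l \<and> l \<le> j}
   \<union> {(qg i j \<otimes>\<^bsub>FQ\<^esub> qg k l, qg k l \<otimes>\<^bsub>FQ\<^esub> qg i j) | i j k l.
        1 \<le> i \<and> i < j \<and> j < k \<and> k < l}"

definition q_to_t :: "((nat \<times> nat) \<times> bool) list \<Rightarrow> (nat \<times> bool) list" where
  "q_to_t = free_lift FT (\<lambda>(i, j). qt (j - 1) \<otimes>\<^bsub>FT\<^esub> qt (j - i) \<otimes>\<^bsub>FT\<^esub> qt (j - 1))"

definition t_to_q :: "(nat \<times> bool) list \<Rightarrow> ((nat \<times> nat) \<times> bool) list" where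
  "t_to_q = free_lift FQ (\<lambda>i.
     if i = 1 then qg 1 2
     else if i = 2 then qg 1 2 \<otimes>\<^bsub>FQ\<^esub> qg 1 3 \<otimes>\<^bsub>FQ\<^esub> qg 1 2
     else qg 1 i \<otimes>\<^bsub>FQ\<^esub> qg 1 (i + 1) \<otimes>\<^bsub>FQ\<^esub> qg 1 i \<otimes>\<^bsub>FQ\<^esub> qg 1 (i - 1))"

end

theory Submission
  imports Defs
begin

text \<open>
  With \<open>p\<^sub>m = t\<^sub>m \<cdots> t\<^sub>1\<close>, the first two families of \<open>t\<close>-relations alone give
  \<open>p\<^sub>m\<^sub>+\<^sub>1 q\<^sub>m p\<^sub>m\<^sub>+\<^sub>1 = q\<^sub>m\<close>, so every \<open>q\<^sub>m\<close> is an involution. Conjugation by \<open>p\<^sub>a\<close> shifts the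
  intervals of the \<open>q\<^bsub>[k,l]\<^esub>\<close> with \<open>l \<le> a\<close> by one, whence, by induction on \<open>a\<close>, conjugation by
  \<open>q\<^sub>a = q\<^bsub>[1,a+1]\<^esub>\<close> reflects all subintervals of \<open>[1, a + 1]\<close>; reflections in a general \<open>[i,j]\<close>
  are composed of three of these. The third family says precisely that \<open>t\<^sub>i\<close> commutes with
  \<open>q\<^bsub>[j,k]\<^esub>\<close> for \<open>i + 1 < j\<close>, which gives the commutation of disjoint intervals. Conversely, the
  elements \<open>t\<^sub>i\<close> built from the \<open>q\<^bsub>[1,n]\<^esub>\<close> satisfy \<open>p\<^sub>m = q\<^bsub>[1,m]\<^esub> q\<^bsub>[1,m+1]\<^esub>\<close>, so the products \<open>q\<^sub>m\<close>
  telescope to \<open>q\<^bsub>[1,m+1]\<^esub>\<close>, and conjugation by \<open>t\<^sub>j\<close> acts on the \<open>q\<^bsub>[1,n]\<^esub>\<close> with \<open>n < j\<close> as four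
  reflections that cancel.
\<close>

section \<open>Commuting elements, involutions, and the products \<open>tprod\<close> and
  \<open>q\<close>\<close>

context group
begin

lemma commute_mult:
  assumes "c \<in> carrier G" "x \<in> carrier G" "y \<in> carrier G"
    and "c \<otimes> x = x \<otimes> c" "c \<otimes> y = y \<otimes> c"
  shows "c \<otimes> (x \<otimes> y) = x \<otimes> y \<otimes> c"
  using assms by (metis m_assoc m_closed)

lemma involution_cancel:
  assumes "x \<in> carrier G" "y \<in> carrier G" "x \<otimes> x = \<one>"
  shows "x \<otimes> (x \<otimes> y) = y"
  using assms by (metis m_assoc l_one)

text \<open>The inverse of a product of two involutions is the product in reverse order. This turns
  relations that make a product square to the identity into commutation statements.\<close>

lemma involutions_commute_iff:
  assumes "x \<in> carrier G" "y \<in> carrier G" "x \<otimes> x = \<one>" "y \<otimes> y = \<one>"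
  shows "(x \<otimes> y) \<otimes> (x \<otimes> y) = \<one> \<longleftrightarrow> x \<otimes> y = y \<otimes> x"
proof -
  have "inv (x \<otimes> y) = y \<otimes> x"
    using assms by (simp add: inv_mult_group inv_equality)
  moreover have "(x \<otimes> y) \<otimes> (x \<otimes> y) = \<one> \<longleftrightarrow> inv (x \<otimes> y) = x \<otimes> y"
    using assms by (metis inv_equality m_closed r_inv)
  ultimately show ?thesis by metis
qed

lemma tprod_closed: "(\<And>i. 1 \<le> i \<Longrightarrow> t i \<in> carrier G) \<Longrightarrow> tprod G t m \<in> carrier G"
  by (induction m) simp_all

lemma q_closed: "(\<And>i. 1 \<le> i \<Longrightarrow> t i \<in> carrier G) \<Longrightarrow> q G t m \<in> carrier G"
  by (induction m) (simp_all add: tprod_closed)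

lemma commute_tprod:
  assumes "\<And>i. 1 \<le> i \<Longrightarrow> t i \<in> carrier G" "c \<in> carrier G"
    and "\<And>i. 1 \<le> i \<Longrightarrow> i \<le> m \<Longrightarrow> c \<otimes> t i = t i \<otimes> c"
  shows "c \<otimes> tprod G t m = tprod G t m \<otimes> c"
  using assms(3)
proof (induction m)
  case (Suc m)
  then show ?case using commute_mult assms(1,2) by (simp add: tprod_closed)
qed (simp add: assms)

lemma commute_q:
  assumes "\<And>i. 1 \<le> i \<Longrightarrow> t i \<in> carrier G" "c \<in> carrier G"
    and "\<And>i. 1 \<le> i \<Longrightarrow> i \<le> m \<Longrightarrow> c \<otimes> t i = t i \<otimes> c"
  shows "c \<otimes> q G t m = q G t m \<otimes> c"
  using assms(3)
proof (induction m)
  case (Suc m)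
  have "c \<otimes> tprod G t (Suc m) = tprod G t (Suc m) \<otimes> c"
    using commute_tprod assms(1,2) Suc.prems by blast
  then show ?case
    using Suc commute_mult assms(1,2) by (simp add: tprod_closed q_closed del: tprod.simps)
qed (simp add: assms)

end

lemma (in group_hom) hom_q:
  assumes "\<And>i. 1 \<le> i \<Longrightarrow> t i \<in> carrier G"
  shows "h (q G t m) = q H (\<lambda>i. h (t i)) m"
proof -
  have "h (tprod G t m) = tprod H (\<lambda>i. h (t i)) m" for m
    by (induction m) (simp_all add: assms G.tprod_closed)
  then show ?thesis
    by (induction m) (simp_all add: assms G.q_closed G.tprod_closed del: tprod.simps)
qed

section \<open>From the \<open>t\<close>-relations to the \<open>q\<close>-relations\<close>

text \<open>The relations are imposed on elements of an arbitrary group, so that they apply both to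
  cosets of generators and to the elements \<open>T i\<close> built below. The bracketing of
  \<open>t_q\<close> isolates the factor that becomes \<open>B j k\<close>.\<close>

locale t_system = group +
  fixes t :: "nat \<Rightarrow> 'a"
  assumes t_closed: "1 \<le> i \<Longrightarrow> t i \<in> carrier G"
    and t_sq: "1 \<le> i \<Longrightarrow> t i \<otimes> t i = \<one>"
    and t_commute: "1 \<le> i \<Longrightarrow> i + 1 < j \<Longrightarrow> t i \<otimes> t j = t j \<otimes> t i"
    and t_q: "1 \<le> i \<Longrightarrow> i + 1 < j \<Longrightarrow> j < k \<Longrightarrow>
      (t i \<otimes> (q G t (k - 1) \<otimes> q G t (k - j) \<otimes> q G t (k - 1))) \<otimes>
      (t i \<otimes> (q G t (k - 1) \<otimes> q G t (k - j) \<otimes> q G t (k - 1))) = \<one>"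
begin

abbreviation P where "P \<equiv> tprod G t"
abbreviation Q where "Q \<equiv> q G t"

definition B :: "nat \<Rightarrow> nat \<Rightarrow> 'a" where
  "B i j = Q (j - 1) \<otimes> Q (j - i) \<otimes> Q (j - 1)"

lemma P_closed: "P m \<in> carrier G" by (simp add: tprod_closed t_closed)
lemma Q_closed: "Q m \<in> carrier G" by (simp add: q_closed t_closed)
lemma B_closed: "B i j \<in> carrier G" by (simp add: B_def Q_closed)

lemmas closed = P_closed Q_closed B_closed t_closed

text \<open>For \<open>1 \<le> k\<close> and \<open>k < l\<close>, both \<open>l - 1\<close> and
  \<open>l - k\<close> are below \<open>l\<close>, so \<open>B k l\<close> is a word in
  \<open>t 1, ..., t (l - 1)\<close>.\<close>

lemma commute_B:
  assumes "c \<in> carrier G" "\<And>i. 1 \<le> i \<Longrightarrow> i < l \<Longrightarrow> c \<otimes> t i = t i \<otimes> c" "1 \<le> k" "k < l"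
  shows "c \<otimes> B k l = B k l \<otimes> c"
proof -
  have "c \<otimes> Q m = Q m \<otimes> c" if "m < l" for m
    using commute_q assms(1,2) t_closed that by auto
  then show ?thesis
    unfolding B_def using assms by (intro commute_mult) (auto simp: closed)
qed

text \<open>Splitting off the newest letter lets the induction hypothesis collapse the middle; that
  letter then passes \<open>Q m\<close>, a word in \<open>t 1, ..., t m\<close>, and
  cancels.\<close>

lemma P_Q_P: "P (Suc m) \<otimes> (Q m \<otimes> P (Suc m)) = Q m"
proof (induction m)
  case 0
  then show ?case by (simp add: t_closed t_sq)
next
  case (Suc m)
  let ?t = "t (Suc (Suc m))"
  have c: "?t \<otimes> Q m = Q m \<otimes> ?t"
    by (rule commute_q) (auto simp: closed intro!: t_commute[symmetric])
  have "P (Suc (Suc m)) \<otimes> (Q (Suc m) \<otimes> P (Suc (Suc m)))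
      = ?t \<otimes> (P (Suc m) \<otimes> (Q m \<otimes> P (Suc m))) \<otimes> (?t \<otimes> P (Suc m))"
    using P_closed[of "Suc m"]
    by (simp add: closed m_assoc del: tprod.simps(2) add: tprod.simps(2)[of _ _ "Suc m"])
  also have "\<dots> = (?t \<otimes> Q m) \<otimes> (?t \<otimes> P (Suc m))"
    by (simp only: Suc)
  also have "\<dots> = Q m \<otimes> (?t \<otimes> (?t \<otimes> P (Suc m)))"
    unfolding c using P_closed[of "Suc m"] by (simp add: closed m_assoc del: tprod.simps)
  also have "\<dots> = Q (Suc m)"
    using P_closed[of "Suc m"] by (simp add: closed involution_cancel t_sq del: tprod.simps)
  finally show ?case .
qed

lemma Q_sq: "Q m \<otimes> Q m = \<one>"
proof (induction m)
  case (Suc m)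
  have "Q (Suc m) \<otimes> Q (Suc m) = Q m \<otimes> (P (Suc m) \<otimes> (Q m \<otimes> P (Suc m)))"
    using P_closed[of "Suc m"] by (simp add: closed m_assoc del: tprod.simps)
  then show ?case by (simp only: P_Q_P Suc)
qed simp

lemma P_Q: "P (Suc m) \<otimes> Q (Suc m) = Q m"
  using P_Q_P by simp

lemma Q_cancel: "x \<in> carrier G \<Longrightarrow> Q m \<otimes> (Q m \<otimes> x) = x"
  by (simp add: Q_closed Q_sq involution_cancel)

lemma B_one: "B 1 j = Q (j - 1)"
  by (simp add: B_def Q_sq closed)

lemma B_sq: "B i j \<otimes> B i j = \<one>"
  by (simp add: B_def m_assoc closed Q_cancel Q_sq)

text \<open>For \<open>a = l\<close>, \<open>P_Q\<close> turns \<open>P l \<otimes> Q l\<close> into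
  \<open>Q (l - 1)\<close>, and the remaining \<open>Q l\<close> splits as
  \<open>Q (l - 1) \<otimes> P l\<close>. Each further letter \<open>t (Suc a)\<close> commutes with
  \<open>B k l\<close>, whose letters have indices below \<open>l \<le> a\<close>.\<close>

lemma shift_B:
  assumes "1 \<le> k" "k < l" "l \<le> a"
  shows "P a \<otimes> B (Suc k) (Suc l) = B k l \<otimes> P a"
  using \<open>l \<le> a\<close>
proof (induction a rule: dec_induct)
  case base
  obtain m where m: "l = Suc m" using assms(2) by (cases l) auto
  have "P l \<otimes> B (Suc k) (Suc l) = (P l \<otimes> Q l) \<otimes> (Q (l - k) \<otimes> Q l)"
    by (simp add: B_def closed m_assoc)
  also have "\<dots> = Q m \<otimes> (Q (l - k) \<otimes> (Q m \<otimes> P l))"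
    using P_Q[of m] by (simp add: m)
  finally show ?case by (simp add: B_def closed m_assoc m del: tprod.simps q.simps)
next
  case (step a)
  have "t (Suc a) \<otimes> B k l = B k l \<otimes> t (Suc a)"
    using assms step.hyps by (intro commute_B) (auto simp: closed intro!: t_commute[symmetric])
  then have "B k l \<otimes> P (Suc a) = t (Suc a) \<otimes> (B k l \<otimes> P a)"
    by (simp add: closed flip: m_assoc)
  then show ?case
    unfolding step.IH[symmetric] by (simp add: closed m_assoc)
qed

text \<open>For \<open>a = l - 1\<close>, conjugation strips the outer factors of
  \<open>B k l\<close> and leaves \<open>Q (l - k)\<close>. In the step, multiplying by
  \<open>P (Suc a)\<close> from the left reduces to conjugation by \<open>Q a\<close>;
  \<open>shift_B\<close> supplies the shift by one, and \<open>P (Suc a)\<close> is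
  cancelled.\<close>

lemma Q_B_Q:
  assumes "1 \<le> k" "k < l" "l \<le> Suc a"
  shows "Q a \<otimes> B k l \<otimes> Q a = B (a + 2 - l) (a + 2 - k)"
proof -
  have "l - 1 \<le> a" using assms by simp
  then show ?thesis
  proof (induction a rule: dec_induct)
    case base
    have "l - 1 + 2 - l = 1" "l - 1 + 2 - k = Suc (l - k)"
      using assms by auto
    then show ?case using assms
      by (simp add: B_one[unfolded One_nat_def] B_def[of k] closed m_assoc Q_cancel Q_sq)
  next
    case (step a)
    let ?C = "B (a + 2 - l) (a + 2 - k)" and ?D = "B (Suc a + 2 - l) (Suc a + 2 - k)"
    have "P (Suc a) \<otimes> (Q (Suc a) \<otimes> B k l \<otimes> Q (Suc a))
        = (P (Suc a) \<otimes> Q (Suc a)) \<otimes> (B k l \<otimes> Q (Suc a))"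
      using closed by (simp add: m_assoc del: tprod.simps q.simps)
    also have "\<dots> = (Q a \<otimes> B k l \<otimes> Q a) \<otimes> P (Suc a)"
      unfolding P_Q using closed(1)[of "Suc a"] by (simp add: closed m_assoc del: tprod.simps)
    also have "\<dots> = P (Suc a) \<otimes> B (Suc (a + 2 - l)) (Suc (a + 2 - k))"
      unfolding step.IH using assms step.hyps by (intro shift_B[symmetric]) auto
    also have "\<dots> = P (Suc a) \<otimes> ?D"
      using assms step.hyps by (simp add: Suc_diff_le del: tprod.simps)
    finally show ?case
      using closed by (simp del: tprod.simps q.simps)
  qed
qed

lemma B_reverse:
  assumes "1 \<le> i" "i \<le> k" "k < l" "l \<le> j"
  shows "B i j \<otimes> B k l \<otimes> B i j = B (i + j - l) (i + j - k)"
proof -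
  let ?a = "j - 1" and ?b = "j - i"
  \<comment> \<open>The three reflections send x to j + 1 - x, then x + 1 - i, then i + j - x. The
    bound \<open>i \<le> k\<close> puts the interval inside [1, j - i + 1] for the second
    one.\<close>
  have "B i j \<otimes> B k l \<otimes> B i j
      = Q ?a \<otimes> (Q ?b \<otimes> (Q ?a \<otimes> B k l \<otimes> Q ?a) \<otimes> Q ?b) \<otimes> Q ?a"
    by (simp add: B_def[of i j] closed m_assoc)
  also have "Q ?a \<otimes> B k l \<otimes> Q ?a = B (j + 1 - l) (j + 1 - k)"
    using assms Q_B_Q[of k l ?a] by simp
  also have "Q ?b \<otimes> \<dots> \<otimes> Q ?b = B (k + 1 - i) (l + 1 - i)"
  proof -
    have "j - i + 2 - (j + 1 - k) = k + 1 - i" "j - i + 2 - (j + 1 - l) = l + 1 - i"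
      using assms by auto
    then show ?thesis
      using assms Q_B_Q[of "j + 1 - l" "j + 1 - k" ?b] by simp
  qed
  also have "Q ?a \<otimes> \<dots> \<otimes> Q ?a = B (i + j - l) (i + j - k)"
  proof -
    have "j - 1 + 2 - (k + 1 - i) = i + j - k" "j - 1 + 2 - (l + 1 - i) = i + j - l"
      using assms by auto
    then show ?thesis
      using assms Q_B_Q[of "k + 1 - i" "l + 1 - i" ?a] by simp
  qed
  finally show ?thesis .
qed

lemma B_commute:
  assumes "1 \<le> i" "i < j" "j < k" "k < l"
  shows "B i j \<otimes> B k l = B k l \<otimes> B i j"
proof -
  \<comment> \<open>Both factors are involutions, so the trivial square in \<open>t_q\<close> means
    commutation; \<open>B i j\<close> is a word in these \<open>t a\<close>.\<close>
  have "t a \<otimes> B k l = B k l \<otimes> t a" if "1 \<le> a" "a < j" for a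
    using t_q[of a k l, folded B_def] that assms involutions_commute_iff[of "t a" "B k l"]
    by (simp add: closed t_sq B_sq)
  then show ?thesis
    using assms by (intro commute_B[of "B k l" j i, symmetric])
      (auto simp: closed)
qed

text \<open>The words of \<open>t_to_q\<close>, evaluated at the \<open>B i j\<close>, recover the
  generators: one of the two composites is the identity.\<close>

lemma t_eq_B:
  shows "t 1 = B 1 2" "t 2 = B 1 2 \<otimes> B 1 3 \<otimes> B 1 2"
    and "2 < i \<Longrightarrow> t i = B 1 i \<otimes> B 1 (i + 1) \<otimes> B 1 i \<otimes> B 1 (i - 1)"
proof -
  \<comment> \<open>The first two factors multiply to \<open>P (Suc (Suc m))\<close>, and
    \<open>P_Q\<close> absorbs all but its first letter. At \<open>m = 0\<close> the last factor is
    \<open>Q 0 = \<one>\<close>, hence the shorter formula for \<open>t 2\<close>.\<close>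
  have eq: "t (Suc (Suc m)) = Q (Suc m) \<otimes> Q (Suc (Suc m)) \<otimes> Q (Suc m) \<otimes> Q m" for m
  proof -
    have "Q (Suc m) \<otimes> Q (Suc (Suc m)) \<otimes> Q (Suc m) \<otimes> Q m
        = t (Suc (Suc m)) \<otimes> (P (Suc m) \<otimes> Q (Suc m)) \<otimes> Q m"
      using Q_closed[of "Suc m"] P_closed[of "Suc m"]
      by (simp add: q.simps(2)[of _ _ "Suc m"] tprod.simps(2)[of _ _ "Suc m"]
          closed m_assoc Q_cancel del: q.simps tprod.simps)
    also have "\<dots> = t (Suc (Suc m))"
      unfolding P_Q by (simp add: closed m_assoc Q_sq)
    finally show ?thesis by simp
  qed
  show "t 1 = B 1 2" unfolding B_one by (simp add: closed)
  show "t 2 = B 1 2 \<otimes> B 1 3 \<otimes> B 1 2"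
    unfolding B_one using eq[of 0] by (simp add: closed numeral_2_eq_2 numeral_3_eq_3)
  show "2 < i \<Longrightarrow> t i = B 1 i \<otimes> B 1 (i + 1) \<otimes> B 1 i \<otimes> B 1 (i - 1)"
    unfolding B_one using eq[of "i - 2"]
    by (cases i; cases "i - 1"; cases "i - 2") (simp_all del: q.simps)
qed

end

section \<open>From the \<open>q\<close>-relations to the \<open>t\<close>-relations\<close>

text \<open>The words of \<open>t_to_q\<close> over an arbitrary group, so that they can be
  transported along homomorphisms.\<close>

definition t_of_q :: "('b, 'c) monoid_scheme \<Rightarrow> (nat \<Rightarrow> nat \<Rightarrow> 'b) \<Rightarrow> nat \<Rightarrow> 'b" where
  "t_of_q G e i =
     (if i = 1 then e 1 2
      else if i = 2 then e 1 2 \<otimes>\<^bsub>G\<^esub> e 1 3 \<otimes>\<^bsub>G\<^esub> e 1 2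
      else e 1 i \<otimes>\<^bsub>G\<^esub> e 1 (i + 1) \<otimes>\<^bsub>G\<^esub> e 1 i \<otimes>\<^bsub>G\<^esub> e 1 (i - 1))"

locale q_system = group +
  fixes e :: "nat \<Rightarrow> nat \<Rightarrow> 'a"
  assumes e_closed: "1 \<le> i \<Longrightarrow> i < j \<Longrightarrow> e i j \<in> carrier G"
    and e_sq: "1 \<le> i \<Longrightarrow> i < j \<Longrightarrow> e i j \<otimes> e i j = \<one>"
    and e_reverse: "1 \<le> i \<Longrightarrow> i \<le> k \<Longrightarrow> k < l \<Longrightarrow> l \<le> j \<Longrightarrow>
      e i j \<otimes> e k l \<otimes> e i j = e (i + j - l) (i + j - k)"
    and e_commute: "1 \<le> i \<Longrightarrow> i < j \<Longrightarrow> j < k \<Longrightarrow> k < l \<Longrightarrow>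
      e i j \<otimes> e k l = e k l \<otimes> e i j"
begin

abbreviation T where "T \<equiv> t_of_q G e"

text \<open>The convention \<open>q\<^bsub>[1,1]\<^esub> = 1\<close>, together with \<open>0 - 1 = 0\<close> on \<open>nat\<close>, makes one formula
  cover all three cases of \<open>t_of_q\<close> in \<open>T_eq_s\<close>.\<close>

definition s :: "nat \<Rightarrow> 'a" where
  "s m = (if m = 0 then \<one> else e 1 (Suc m))"

lemma s_closed: "s m \<in> carrier G"
  by (simp add: s_def e_closed)

lemma s_sq: "s m \<otimes> s m = \<one>"
  by (simp add: s_def e_sq)

lemma s_cancel: "x \<in> carrier G \<Longrightarrow> s m \<otimes> (s m \<otimes> x) = x"
  by (simp add: s_closed s_sq involution_cancel)

lemma s_reverse:
  assumes "1 \<le> k" "k < l" "l \<le> Suc m"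
  shows "s m \<otimes> e k l = e (m + 2 - l) (m + 2 - k) \<otimes> s m"
proof -
  \<comment> \<open>The bounds force \<open>0 < m\<close>, so \<open>s m\<close> is the generator
    \<open>e 1 (Suc m)\<close>.\<close>
  have "s m \<otimes> e k l \<otimes> s m = e (m + 2 - l) (m + 2 - k)"
    using assms e_reverse[of 1 k l "Suc m"] by (simp add: s_def)
  then show ?thesis
    using assms by (metis e_closed m_assoc m_closed r_one s_closed s_sq)
qed

lemma T_eq_s: "T (Suc m) = s m \<otimes> s (Suc m) \<otimes> s m \<otimes> s (m - 1)"
  by (auto simp: t_of_q_def s_def e_closed numeral_2_eq_2 numeral_3_eq_3)

lemma T_closed: "1 \<le> i \<Longrightarrow> T i \<in> carrier G"
  using T_eq_s[of "i - 1"] by (simp add: s_closed)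

lemma commute_T:
  assumes "c \<in> carrier G" "\<And>n. 1 < n \<Longrightarrow> n \<le> Suc i \<Longrightarrow> c \<otimes> e 1 n = e 1 n \<otimes> c" "1 \<le> i"
  shows "c \<otimes> T i = T i \<otimes> c"
proof -
  have "c \<otimes> s m = s m \<otimes> c" if "m \<le> i" for m
    using that assms(1,2) by (auto simp: s_def)
  then show ?thesis
    using assms T_eq_s[of "i - 1"] by (auto simp: s_closed intro!: commute_mult)
qed

text \<open>In the step, the last two factors of \<open>T (Suc (Suc m))\<close> are
  \<open>s (Suc m) \<otimes> s m\<close>, which cancel the previous product.\<close>

lemma tprod_T: "tprod G T (Suc m) = s m \<otimes> s (Suc m)"
proof (induction m)
  case 0
  then show ?case by (simp add: T_eq_s s_closed s_def e_closed)
next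
  case (Suc m)
  have "tprod G T (Suc (Suc m)) = T (Suc (Suc m)) \<otimes> (s m \<otimes> s (Suc m))"
    by (simp only: tprod.simps(2)[of _ _ "Suc m"] Suc)
  then show ?case
    by (simp add: T_eq_s s_closed m_assoc s_cancel s_sq)
qed

lemma q_T: "q G T m = s m"
  by (induction m) (simp_all add: tprod_T s_cancel s_closed del: tprod.simps, simp add: s_def)

text \<open>The reflection in [1, j] carries [1, j - i + 1] to [i, j]. This gives the other
  composite, on the generators \<open>e i j\<close>.\<close>

lemma e_eq_q:
  assumes "1 \<le> i" "i < j"
  shows "q G T (j - 1) \<otimes> q G T (j - i) \<otimes> q G T (j - 1) = e i j"
  using assms e_reverse[of 1 1 "Suc (j - i)" j] by (simp add: q_T s_def)

lemma T_e:
  assumes "1 < n" "n < j"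
  shows "T j \<otimes> e 1 n = e 1 n \<otimes> T j"
proof -
  obtain m where j: "j = Suc (Suc m)" using assms by (cases j; cases "j - 1") auto
  have n: "n \<le> Suc m" using assms j by simp
  have "T j \<otimes> e 1 n = s (Suc m) \<otimes> (s (Suc (Suc m)) \<otimes> (s (Suc m) \<otimes> (s m \<otimes> e 1 n)))"
    using assms by (simp add: j T_eq_s s_closed e_closed m_assoc)
  \<comment> \<open>The interval moves from [1, n] to [m + 2 - n, m + 1], [2, n + 1],
    [m + 3 - n, m + 2] and back to [1, n].\<close>
  also have "s m \<otimes> e 1 n = e (Suc (Suc m) - n) (Suc m) \<otimes> s m"
    using s_reverse[of 1 n m] assms n by simp
  also have "s (Suc m) \<otimes> \<dots> = e 2 (Suc n) \<otimes> (s (Suc m) \<otimes> s m)"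
    using s_reverse[of "Suc (Suc m) - n" "Suc m" "Suc m"] assms n
    by (simp add: s_closed e_closed numeral_2_eq_2 Suc_diff_le flip: m_assoc)
  also have "s (Suc (Suc m)) \<otimes> \<dots>
      = e (m + 3 - n) (m + 2) \<otimes> (s (Suc (Suc m)) \<otimes> (s (Suc m) \<otimes> s m))"
    using s_reverse[of 2 "Suc n" "Suc (Suc m)"] assms n
    by (simp add: s_closed e_closed numeral_2_eq_2 numeral_3_eq_3 flip: m_assoc)
  also have "s (Suc m) \<otimes> \<dots>
      = e 1 n \<otimes> (s (Suc m) \<otimes> (s (Suc (Suc m)) \<otimes> (s (Suc m) \<otimes> s m)))"
    using s_reverse[of "m + 3 - n" "m + 2" "Suc m"] assms n
    by (simp add: s_closed e_closed numeral_2_eq_2 numeral_3_eq_3 flip: m_assoc)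
  also have "\<dots> = e 1 n \<otimes> T j"
    using assms by (simp add: j T_eq_s s_closed e_closed m_assoc)
  finally show ?thesis .
qed

text \<open>For \<open>i \<ge> 3\<close>, \<open>T i\<close> is a conjugate of a product of the commuting involutions
  \<open>e 1 (i + 1)\<close> and \<open>e 2 i\<close>.\<close>

lemma T_sq:
  assumes "1 \<le> i"
  shows "T i \<otimes> T i = \<one>"
proof (cases "i \<le> 2")
  case True
  then have "i = 1 \<or> i = 2" using assms by auto
  then show ?thesis
    by (auto simp: t_of_q_def e_closed e_sq involution_cancel m_assoc)
next
  case False
  then obtain m where i: "i = Suc (Suc (Suc m))"
    by (cases i; cases "i - 1"; cases "i - 2") auto
  let ?x = "s (Suc (Suc m))" and ?y = "s i" and ?z = "e 2 i"
  have z: "?z \<in> carrier G" "?z \<otimes> ?z = \<one>" by (simp_all add: e_closed e_sq i)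
  \<comment> \<open>\<open>e 1 (Suc (Suc m))\<close> is the last factor \<open>s (Suc m)\<close> of
    \<open>T i\<close>; moving \<open>?x\<close> past it produces the conjugated form.\<close>
  have "?x \<otimes> e 1 (Suc (Suc m)) = ?z \<otimes> ?x"
    using s_reverse[of 1 "Suc (Suc m)" "Suc (Suc m)"] by (simp add: i)
  then have T: "T i = ?x \<otimes> (?y \<otimes> (?z \<otimes> ?x))"
    using T_eq_s[of "Suc (Suc m)"] by (simp add: i s_closed m_assoc e_closed) (simp add: s_def)
  \<comment> \<open>The reflection in [1, i + 1] fixes [2, i].\<close>
  have "?y \<otimes> ?z = ?z \<otimes> ?y"
    using s_reverse[of 2 i i] by (simp add: i)
  then have "(?y \<otimes> ?z) \<otimes> (?y \<otimes> ?z) = \<one>"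
    using involutions_commute_iff z s_closed s_sq by blast
  then have "((?y \<otimes> ?z) \<otimes> (?y \<otimes> ?z)) \<otimes> ?x = ?x"
    by (simp add: s_closed)
  then have yz: "?y \<otimes> (?z \<otimes> (?y \<otimes> (?z \<otimes> ?x))) = ?x"
    using z(1) by (simp only: s_closed m_assoc m_closed)
  have "T i \<otimes> T i = ?x \<otimes> (?y \<otimes> (?z \<otimes> (?x \<otimes> (?x \<otimes> (?y \<otimes> (?z \<otimes> ?x))))))"
    unfolding T using z(1) by (simp only: s_closed m_assoc m_closed)
  also have "?x \<otimes> (?x \<otimes> (?y \<otimes> (?z \<otimes> ?x))) = ?y \<otimes> (?z \<otimes> ?x)"
    using z(1) by (intro s_cancel) (simp add: s_closed)
  finally show ?thesis
    by (simp only: yz s_sq)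
qed

lemma T_commute:
  assumes "1 \<le> i" "i + 1 < j"
  shows "T i \<otimes> T j = T j \<otimes> T i"
  using assms by (intro commute_T[of "T j" i, symmetric]) (auto simp: T_closed intro!: T_e[unfolded One_nat_def])

text \<open>\<open>T i\<close> is a word in the \<open>e 1 n\<close> with
  \<open>n \<le> i + 1\<close>, and each such [1, n] ends before \<open>j\<close>.\<close>

lemma T_e_commute:
  assumes "1 \<le> i" "i + 1 < j" "j < k"
  shows "T i \<otimes> e j k = e j k \<otimes> T i"
  using assms
  by (intro commute_T[of "e j k" i, symmetric])
    (auto simp: e_closed intro!: e_commute[unfolded One_nat_def, symmetric])

lemma t_system_T: "t_system G T"
proof unfold_locales
  fix i j k :: nat assume *: "1 \<le> i" "i + 1 < j" "j < k"
  have "(T i \<otimes> e j k) \<otimes> (T i \<otimes> e j k) = \<one>"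
    using * T_e_commute[of i j k]
    by (subst involutions_commute_iff) (auto simp: T_closed e_closed T_sq e_sq)
  moreover have "q G T (k - 1) \<otimes> q G T (k - j) \<otimes> q G T (k - 1) = e j k"
    using * by (intro e_eq_q) auto
  ultimately show "(T i \<otimes> (q G T (k - 1) \<otimes> q G T (k - j) \<otimes> q G T (k - 1))) \<otimes>
      (T i \<otimes> (q G T (k - 1) \<otimes> q G T (k - j) \<otimes> q G T (k - 1))) = \<one>"
    by simp
qed (blast intro: T_closed T_sq T_commute)+

end

lemma (in t_system) q_system_B: "q_system G B"
  by unfold_locales (blast intro: B_closed B_sq B_reverse B_commute)+

section \<open>The presented groups\<close>

lemma relation_subgroup_normal:
  assumes "R \<subseteq> carrier (free_group S) \<times> carrier (free_group S)"
  shows "relation_subgroup S R \<lhd> free_group S"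
proof -
  interpret group "free_group S" by (rule group_free_group)
  show ?thesis
    unfolding relation_subgroup_def
    by (rule normal_closure_normal) (use assms in \<open>auto simp: is_group\<close>)
qed

lemma group_hom_presented_coset:
  assumes "R \<subseteq> carrier (free_group S) \<times> carrier (free_group S)"
  shows "group_hom (free_group S) (presented_group S R)
    (\<lambda>w. relation_subgroup S R #>\<^bsub>free_group S\<^esub> w)"
  using normal.r_coset_hom_Mod[OF relation_subgroup_normal[OF assms]] group_presented_group[OF assms]
  by (simp add: group_hom_def group_hom_axioms_def group_free_group flip: presented_group_def)

lemma presented_coset_eq:
  assumes R: "R \<subseteq> carrier (free_group S) \<times> carrier (free_group S)" and uv: "(u, v) \<in> R"
  shows "relation_subgroup S R #>\<^bsub>free_group S\<^esub> u = relation_subgroup S R #>\<^bsub>free_group S\<^esub> v"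
proof -
  interpret group "free_group S" by (rule group_free_group)
  interpret N: normal "relation_subgroup S R" "free_group S"
    by (rule relation_subgroup_normal[OF R])
  have "u \<otimes>\<^bsub>free_group S\<^esub> inv\<^bsub>free_group S\<^esub> v \<in> relation_subgroup S R"
    using uv by (auto simp: relation_subgroup_def normal_closure_def)
  then show ?thesis
    using R uv by (intro coset_mult_inv1 coset_join2) (auto intro: N.subgroup_axioms N.subset)
qed

text \<open>Von Dyck's theorem: the kernel of \<open>h\<close> is normal and contains the relators,
  hence their normal closure, so \<open>h\<close> factors through the quotient.\<close>

lemma presented_universal:
  assumes R: "R \<subseteq> carrier (free_group S) \<times> carrier (free_group S)"
    and h: "group_hom (free_group S) H h" and eq: "\<forall>(u, v) \<in> R. h u = h v"
  obtains g where "g \<in> hom (presented_group S R) H"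
    and "\<And>w. w \<in> carrier (free_group S) \<Longrightarrow>
      g (relation_subgroup S R #>\<^bsub>free_group S\<^esub> w) = h w"
proof -
  interpret group_hom "free_group S" H h by fact
  have "{u \<otimes>\<^bsub>free_group S\<^esub> inv\<^bsub>free_group S\<^esub> v | u v. (u, v) \<in> R} \<subseteq> kernel (free_group S) H h"
  proof clarify
    fix u v assume uv: "(u, v) \<in> R"
    then have "u \<in> carrier (free_group S)" "v \<in> carrier (free_group S)" "h u = h v"
      using R eq by auto
    then show "u \<otimes>\<^bsub>free_group S\<^esub> inv\<^bsub>free_group S\<^esub> v \<in> kernel (free_group S) H h"
      by (simp add: kernel_def)
  qed
  then have "relation_subgroup S R \<subseteq> kernel (free_group S) H h"
    unfolding relation_subgroup_def normal_closure_def using normal_kernel by blast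
  then show thesis
    using FactGroup_universal_kernel[OF relation_subgroup_normal[OF R]] that
    by (metis presented_group_def)
qed

lemma presented_carrierE:
  assumes "X \<in> carrier (presented_group S R)"
  obtains w where "w \<in> carrier (free_group S)" "X = relation_subgroup S R #>\<^bsub>free_group S\<^esub> w"
  using assms by (auto simp: presented_group_def FactGroup_def RCOSETS_def)

section \<open>The relations as conditions on images of generators\<close>

lemma tg_closed: "1 \<le> i \<Longrightarrow> tg i \<in> carrier FT"
  by (simp add: free_gen_closed t_index_def)

lemma qg_closed: "1 \<le> i \<Longrightarrow> i < j \<Longrightarrow> qg i j \<in> carrier FQ"
  by (simp add: free_gen_closed q_index_def)

lemma qt_closed: "qt m \<in> carrier FT"
  by (rule group.q_closed[OF group_free_group]) (rule tg_closed)

lemma t_relations_closed: "t_relations \<subseteq> carrier FT \<times> carrier FT"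
proof -
  interpret group FT by (rule group_free_group)
  show ?thesis
    by (auto simp: t_relations_def tg_closed[simplified] qt_closed)
qed

lemma q_relations_closed: "q_relations \<subseteq> carrier FQ \<times> carrier FQ"
proof -
  interpret group FQ by (rule group_free_group)
  show ?thesis
    by (fastforce simp: q_relations_def intro: m_closed qg_closed)
qed

lemma ball_pairs:
  "(\<forall>(u, v) \<in> {(f1 i, g1 i) | i. P1 i}. R u v) \<longleftrightarrow> (\<forall>i. P1 i \<longrightarrow> R (f1 i) (g1 i))"
  "(\<forall>(u, v) \<in> {(f2 i j, g2 i j) | i j. P2 i j}. R u v) \<longleftrightarrow>
    (\<forall>i j. P2 i j \<longrightarrow> R (f2 i j) (g2 i j))"
  "(\<forall>(u, v) \<in> {(f3 i j k, g3 i j k) | i j k. P3 i j k}. R u v) \<longleftrightarrow>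
    (\<forall>i j k. P3 i j k \<longrightarrow> R (f3 i j k) (g3 i j k))"
  "(\<forall>(u, v) \<in> {(f4 i j k l, g4 i j k l) | i j k l. P4 i j k l}. R u v) \<longleftrightarrow>
    (\<forall>i j k l. P4 i j k l \<longrightarrow> R (f4 i j k l) (g4 i j k l))"
  by blast+

lemma t_relations_iff:
  assumes "group_hom FT H h"
  shows "(\<forall>(u, v) \<in> t_relations. h u = h v) \<longleftrightarrow> t_system H (\<lambda>i. h (tg i))"
proof -
  interpret group_hom FT H h by fact
  let ?t = "\<lambda>i. h (tg i)"
  let ?c = "\<lambda>i j k. ?t i \<otimes>\<^bsub>H\<^esub> (q H ?t (k - 1) \<otimes>\<^bsub>H\<^esub> q H ?t (k - j) \<otimes>\<^bsub>H\<^esub> q H ?t (k - 1))"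
  have h_qt: "h (qt m) = q H ?t m" for m
    by (rule hom_q) (rule tg_closed)
  have sq: "h (w [^]\<^bsub>FT\<^esub> (2::nat)) = h w \<otimes>\<^bsub>H\<^esub> h w" if "w \<in> carrier FT" for w
    using that by (simp add: numeral_2_eq_2)
  have q_in: "q H ?t m \<in> carrier H" for m
    by (intro H.q_closed hom_closed tg_closed)
  have "(\<forall>(u, v) \<in> t_relations. h u = h v) \<longleftrightarrow>
      (\<forall>i. 1 \<le> i \<longrightarrow> ?t i \<otimes>\<^bsub>H\<^esub> ?t i = \<one>\<^bsub>H\<^esub>) \<and>
      (\<forall>i j. 1 \<le> i \<and> 1 \<le> j \<and> \<bar>int i - int j\<bar> > 1 \<longrightarrow> ?t i \<otimes>\<^bsub>H\<^esub> ?t j = ?t j \<otimes>\<^bsub>H\<^esub> ?t i) \<and>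
      (\<forall>i j k. 1 \<le> i \<and> i + 1 < j \<and> j < k \<longrightarrow> ?c i j k \<otimes>\<^bsub>H\<^esub> ?c i j k = \<one>\<^bsub>H\<^esub>)"
    unfolding t_relations_def ball_Un ball_pairs
    by (simp only: sq hom_mult hom_one h_qt H.m_assoc G.m_closed H.m_closed hom_closed
        tg_closed qt_closed q_in conj_assoc cong: imp_cong)
  \<comment> \<open>Commutation is symmetric, so the order \<open>i + 1 < j\<close> covers the
    absolute value.\<close>
  also have "(\<forall>i j. 1 \<le> i \<and> 1 \<le> j \<and> \<bar>int i - int j\<bar> > 1 \<longrightarrow> ?t i \<otimes>\<^bsub>H\<^esub> ?t j = ?t j \<otimes>\<^bsub>H\<^esub> ?t i) \<longleftrightarrow>
      (\<forall>i j. 1 \<le> i \<longrightarrow> i + 1 < j \<longrightarrow> ?t i \<otimes>\<^bsub>H\<^esub> ?t j = ?t j \<otimes>\<^bsub>H\<^esub> ?t i)"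
    (is "?B \<longleftrightarrow> ?B'")
  proof
    assume B: ?B'
    show ?B
    proof (intro allI impI)
      fix i j :: nat assume "1 \<le> i \<and> 1 \<le> j \<and> \<bar>int i - int j\<bar> > 1"
      then consider "1 \<le> i" "i + 1 < j" | "1 \<le> j" "j + 1 < i" by linarith
      then show "?t i \<otimes>\<^bsub>H\<^esub> ?t j = ?t j \<otimes>\<^bsub>H\<^esub> ?t i"
        by cases (use B in \<open>blast intro: sym\<close>)+
    qed
  qed simp
  also have "(\<forall>i. 1 \<le> i \<longrightarrow> ?t i \<otimes>\<^bsub>H\<^esub> ?t i = \<one>\<^bsub>H\<^esub>) \<and> ?B' \<and>
      (\<forall>i j k. 1 \<le> i \<and> i + 1 < j \<and> j < k \<longrightarrow> ?c i j k \<otimes>\<^bsub>H\<^esub> ?c i j k = \<one>\<^bsub>H\<^esub>) \<longleftrightarrow> t_system H ?t"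
    unfolding t_system_def t_system_axioms_def
    by (simp only: H.is_group tg_closed hom_closed simp_thms imp_conjL cong: imp_cong)
  finally show ?thesis .
qed

lemma q_relations_iff:
  assumes "group_hom FQ H h"
  shows "(\<forall>(u, v) \<in> q_relations. h u = h v) \<longleftrightarrow> q_system H (\<lambda>i j. h (qg i j))"
proof -
  interpret group_hom FQ H h by fact
  let ?e = "\<lambda>i j. h (qg i j)"
  have sq: "h (w [^]\<^bsub>FQ\<^esub> (2::nat)) = h w \<otimes>\<^bsub>H\<^esub> h w" if "w \<in> carrier FQ" for w
    using that by (simp add: numeral_2_eq_2)
  have reverse: "h (qg i j \<otimes>\<^bsub>FQ\<^esub> qg k l \<otimes>\<^bsub>FQ\<^esub> qg i j) = ?e i j \<otimes>\<^bsub>H\<^esub> ?e k l \<otimes>\<^bsub>H\<^esub> ?e i j"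
    if "1 \<le> i" "i \<le> k" "k < l" "l \<le> j" for i j k l
    using that qg_closed[of i j] qg_closed[of k l] by simp
  have commute: "h (qg i j \<otimes>\<^bsub>FQ\<^esub> qg k l) = ?e i j \<otimes>\<^bsub>H\<^esub> ?e k l"
    "h (qg k l \<otimes>\<^bsub>FQ\<^esub> qg i j) = ?e k l \<otimes>\<^bsub>H\<^esub> ?e i j"
    if "1 \<le> i" "i < j" "j < k" "k < l" for i j k l
    using that qg_closed[of i j] qg_closed[of k l] by simp_all
  show ?thesis
    unfolding q_relations_def ball_Un ball_pairs q_system_def q_system_axioms_def
    by (simp only: sq reverse commute hom_one H.is_group qg_closed hom_closed simp_thms
        imp_conjL conj_assoc cong: imp_cong) blast
qed

section \<open>The homomorphisms \<open>q_to_t\<close> and \<open>t_to_q\<close> on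
  generators\<close>

lemma hom_free_group_eqI:
  assumes "group H" "f \<in> hom (free_group S) H" "g \<in> hom (free_group S) H"
    and "\<And>a. a \<in> S \<Longrightarrow> f (free_gen a) = g (free_gen a)" and "w \<in> carrier (free_group S)"
  shows "f w = g w"
  using assms free_lift_unique[of H f S "\<lambda>a. g (free_gen a)" w]
    free_lift_unique[of H g S "\<lambda>a. g (free_gen a)" w] by simp

lemma q_to_t_hom: "q_to_t \<in> hom FQ FT"
proof -
  interpret group FT by (rule group_free_group)
  show ?thesis unfolding q_to_t_def
    by (intro free_lift_hom is_group) (auto simp: qt_closed)
qed

lemma q_to_t_gen: "q_to_t (qg i j) = qt (j - 1) \<otimes>\<^bsub>FT\<^esub> qt (j - i) \<otimes>\<^bsub>FT\<^esub> qt (j - 1)"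
proof -
  interpret group FT by (rule group_free_group)
  show ?thesis unfolding q_to_t_def
    by (subst free_lift_free_gen) (auto simp: qt_closed is_group)
qed

lemma t_of_q_qg_closed:
  assumes "1 \<le> i"
  shows "t_of_q FQ qg i \<in> carrier FQ"
proof -
  interpret group FQ by (rule group_free_group)
  show ?thesis
    using assms by (auto simp: t_of_q_def intro!: m_closed qg_closed[simplified])
qed

lemma t_to_q_eq: "t_to_q = free_lift FQ (t_of_q FQ qg)"
  by (simp add: t_to_q_def t_of_q_def[abs_def])

lemma t_to_q_hom: "t_to_q \<in> hom FT FQ"
  unfolding t_to_q_eq
  by (intro free_lift_hom group_free_group) (auto simp: t_index_def t_of_q_qg_closed)

lemma t_to_q_gen: "1 \<le> i \<Longrightarrow> t_to_q (tg i) = t_of_q FQ qg i"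
  unfolding t_to_q_eq by (intro free_lift_free_gen group_free_group t_of_q_qg_closed)

lemma (in group_hom) hom_t_of_q:
  assumes "\<And>i j. 1 \<le> i \<Longrightarrow> i < j \<Longrightarrow> e i j \<in> carrier G" "1 \<le> i"
  shows "h (t_of_q G e i) = t_of_q H (\<lambda>i j. h (e i j)) i"
  using assms by (simp add: t_of_q_def)

text \<open>Agreement from index 1 on suffices, as \<open>tprod\<close> and \<open>q\<close> never
  evaluate \<open>t\<close> at 0. This matters because \<open>tg 0\<close> is not a generator of
  \<open>FT\<close>.\<close>

lemma t_system_cong:
  assumes "t_system H t" "\<And>i. 1 \<le> i \<Longrightarrow> t i = t' i"
  shows "t_system H t'"
proof -
  interpret t_system H t by fact
  have "tprod H t m = tprod H t' m" for m
    by (induction m) (simp_all add: assms(2))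
  then have q: "q H t m = q H t' m" for m
    by (induction m) (simp_all add: assms(2))
  show ?thesis
    using t_closed t_sq t_commute t_q
    by unfold_locales (simp_all only: q assms(2))
qed

section \<open>The induced maps between the presented groups\<close>

theorem theorem1p8:
  shows "q_to_t \<in> hom FQ FT \<and> t_to_q \<in> hom FT FQ \<and>
    (\<exists>\<Phi> \<Psi>.
      (\<forall>w \<in> carrier FQ.
         \<Phi> (relation_subgroup q_index q_relations #>\<^bsub>FQ\<^esub> w)
           = relation_subgroup t_index t_relations #>\<^bsub>FT\<^esub> q_to_t w) \<and>
      (\<forall>w \<in> carrier FT.
         \<Psi> (relation_subgroup t_index t_relations #>\<^bsub>FT\<^esub> w)
           = relation_subgroup q_index q_relations #>\<^bsub>FQ\<^esub> t_to_q w) \<and>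
      group_isomorphisms (presented_group q_index q_relations)
        (presented_group t_index t_relations) \<Phi> \<Psi>)"
proof -
  define \<pi>T where "\<pi>T w = relation_subgroup t_index t_relations #>\<^bsub>FT\<^esub> w" for w
  define \<pi>Q where "\<pi>Q w = relation_subgroup q_index q_relations #>\<^bsub>FQ\<^esub> w" for w
  let ?GT = "presented_group t_index t_relations" and ?GQ = "presented_group q_index q_relations"
  interpret T: group_hom FT ?GT \<pi>T
    unfolding \<pi>T_def by (rule group_hom_presented_coset[OF t_relations_closed])
  interpret Q: group_hom FQ ?GQ \<pi>Q
    unfolding \<pi>Q_def by (rule group_hom_presented_coset[OF q_relations_closed])
  interpret qt: group_hom FQ FT q_to_t
    by unfold_locales (rule q_to_t_hom)
  \<comment> \<open>The cosets of the generators satisfy the defining relations, so the results of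
    both locales apply to them.\<close>
  have "\<forall>(u, v) \<in> t_relations. \<pi>T u = \<pi>T v"
    unfolding \<pi>T_def using presented_coset_eq[OF t_relations_closed] by blast
  then interpret TS: t_system ?GT "\<lambda>i. \<pi>T (tg i)"
    using t_relations_iff T.group_hom_axioms by blast
  have "\<forall>(u, v) \<in> q_relations. \<pi>Q u = \<pi>Q v"
    unfolding \<pi>Q_def using presented_coset_eq[OF q_relations_closed] by blast
  then interpret QS: q_system ?GQ "\<lambda>i j. \<pi>Q (qg i j)"
    using q_relations_iff Q.group_hom_axioms by blast

  have hT: "group_hom FQ ?GT (\<lambda>w. \<pi>T (q_to_t w))"
    using hom_compose[OF q_to_t_hom T.homh] by unfold_locales (simp add: comp_def)
  have hQ: "group_hom FT ?GQ (\<lambda>w. \<pi>Q (t_to_q w))"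
    using hom_compose[OF t_to_q_hom Q.homh] by unfold_locales (simp add: comp_def)
  have B: "\<pi>T (q_to_t (qg i j)) = TS.B i j" for i j
    by (simp add: q_to_t_gen TS.B_def qt_closed tg_closed T.hom_q)
  have tq: "\<pi>Q (t_to_q (tg i)) = t_of_q ?GQ (\<lambda>i j. \<pi>Q (qg i j)) i" if "1 \<le> i" for i
    using that by (simp add: t_to_q_gen Q.hom_t_of_q qg_closed)

  \<comment> \<open>The images \<open>TS.B i j\<close> form a \<open>q_system\<close>, so the
    composite map respects \<open>q_relations\<close> and descends.\<close>
  have "\<forall>(u, v) \<in> q_relations. \<pi>T (q_to_t u) = \<pi>T (q_to_t v)"
    using q_relations_iff[OF hT] TS.q_system_B by (simp add: B)
  then obtain \<Phi> where \<Phi>: "\<Phi> \<in> hom ?GQ ?GT" "\<And>w. w \<in> carrier FQ \<Longrightarrow> \<Phi> (\<pi>Q w) = \<pi>T (q_to_t w)"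
    using presented_universal[OF q_relations_closed hT] unfolding \<pi>Q_def by blast
  have "t_system ?GQ (\<lambda>i. \<pi>Q (t_to_q (tg i)))"
    using QS.t_system_T by (rule t_system_cong) (simp add: tq)
  then have "\<forall>(u, v) \<in> t_relations. \<pi>Q (t_to_q u) = \<pi>Q (t_to_q v)"
    using t_relations_iff[OF hQ] by blast
  then obtain \<Psi> where \<Psi>: "\<Psi> \<in> hom ?GT ?GQ" "\<And>w. w \<in> carrier FT \<Longrightarrow> \<Psi> (\<pi>T w) = \<pi>Q (t_to_q w)"
    using presented_universal[OF t_relations_closed hQ] unfolding \<pi>T_def by blast

  \<comment> \<open>Homomorphisms on a free group are compared on generators only.\<close>
  have "\<Psi> (\<Phi> (\<pi>Q w)) = \<pi>Q w" if "w \<in> carrier FQ" for w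
  proof (rule hom_free_group_eqI[OF _ _ Q.homh _ that])
    show "(\<lambda>w. \<Psi> (\<Phi> (\<pi>Q w))) \<in> hom FQ ?GQ"
      using hom_compose[OF hom_compose[OF Q.homh \<Phi>(1)] \<Psi>(1)] by (simp add: comp_def)
    fix a assume "a \<in> q_index"
    then obtain i j where a: "a = (i, j)" "1 \<le> i" "i < j" by (auto simp: q_index_def)
    have "\<Psi> (\<Phi> (\<pi>Q (qg i j))) = \<pi>Q (t_to_q (q_to_t (qg i j)))"
      using a by (simp add: \<Phi> \<Psi> qg_closed)
    \<comment> \<open>In the quotient \<open>t_to_q (tg i)\<close> becomes \<open>QS.T i\<close>, so
      each \<open>qt m\<close> becomes \<open>q ?GQ QS.T m\<close>.\<close>
    also have "\<dots> = q ?GQ QS.T (j - 1) \<otimes>\<^bsub>?GQ\<^esub> q ?GQ QS.T (j - i) \<otimes>\<^bsub>?GQ\<^esub> q ?GQ QS.T (j - 1)"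
    proof -
      interpret hQ: group_hom FT ?GQ "\<lambda>w. \<pi>Q (t_to_q w)" by (rule hQ)
      have *: "tprod ?GQ (\<lambda>i. \<pi>Q (t_to_q (tg i))) m = tprod ?GQ QS.T m" for m
        by (induction m) (simp_all add: tq)
      have "q ?GQ (\<lambda>i. \<pi>Q (t_to_q (tg i))) m = q ?GQ QS.T m" for m
        by (induction m) (simp_all add: * tq)
      then have "\<pi>Q (t_to_q (qt m)) = q ?GQ QS.T m" for m
        using hQ.hom_q[of tg m] by (simp add: tg_closed)
      then show ?thesis
        by (simp add: q_to_t_gen qt_closed)
    qed
    also have "\<dots> = \<pi>Q (qg i j)"
      using a by (intro QS.e_eq_q)
    finally show "\<Psi> (\<Phi> (\<pi>Q (free_gen a))) = \<pi>Q (free_gen a)"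
      by (simp add: a)
  qed (rule Q.H.is_group)
  then have inv1: "\<forall>x \<in> carrier ?GQ. \<Psi> (\<Phi> x) = x"
    unfolding \<pi>Q_def by (metis presented_carrierE)

  have "\<Phi> (\<Psi> (\<pi>T w)) = \<pi>T w" if "w \<in> carrier FT" for w
  proof (rule hom_free_group_eqI[OF _ _ T.homh _ that])
    show "(\<lambda>w. \<Phi> (\<Psi> (\<pi>T w))) \<in> hom FT ?GT"
      using hom_compose[OF hom_compose[OF T.homh \<Psi>(1)] \<Phi>(1)] by (simp add: comp_def)
    fix i assume "i \<in> t_index"
    then have i: "1 \<le> i" by (simp add: t_index_def)
    interpret hT: group_hom FQ ?GT "\<lambda>w. \<pi>T (q_to_t w)" by (rule hT)
    have "\<Phi> (\<Psi> (\<pi>T (tg i))) = \<pi>T (q_to_t (t_of_q FQ qg i))"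
      using i by (simp add: \<Phi> \<Psi> tg_closed t_to_q_gen t_of_q_qg_closed)
    \<comment> \<open>The generators of \<open>FQ\<close> become \<open>TS.B i j\<close>, from which
      \<open>TS.t_eq_B\<close> recovers the coset of \<open>tg i\<close>.\<close>
    also have "\<dots> = t_of_q ?GT TS.B i"
      using i hT.hom_t_of_q[of qg i] by (simp add: qg_closed B)
    also have "\<dots> = \<pi>T (tg i)"
      using i TS.t_eq_B(1,2) TS.t_eq_B(3)[of i] by (simp add: t_of_q_def)
    finally show "\<Phi> (\<Psi> (\<pi>T (tg i))) = \<pi>T (tg i)" .
  qed (rule T.H.is_group)
  then have inv2: "\<forall>x \<in> carrier ?GT. \<Phi> (\<Psi> x) = x"
    unfolding \<pi>T_def by (metis presented_carrierE)

  have "group_isomorphisms ?GQ ?GT \<Phi> \<Psi>"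
    using \<Phi>(1) \<Psi>(1) inv1 inv2 by (simp add: group_isomorphisms_def)
  then show ?thesis
    using q_to_t_hom t_to_q_hom \<Phi>(2) \<Psi>(2) unfolding \<pi>T_def \<pi>Q_def by blast
qed

end
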